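(* The usual hyperbolic laws of cosines and sines hold for supertriangles. That is, let $\mathbf A,\mathbf B,\mathbf C\in\mathbb{H}_s$ be three points of the super hyperbolic plane not lying on a common supergeodesic, and consider the supertriangle they determine, with sides of lengths $A,B,C$ opposite to $\mathbf A,\mathbf B,\mathbf C$ respectively and with opposite angles $a,b,c$ (at $\mathbf A,\mathbf B,\mathbf C$ respectively). Then $$\cosh A=\cosh B\,\cosh C-\sinh B\,\sinh C\,\cos a,$$ $$\cos a=-\cos b\,\cos c+\sin b\,\sin c\,\cosh A,$$ $$\frac{\sin a}{\sinh A}=\frac{\sin b}{\sinh B}=\frac{\sin c}{\sinh C}.$$
   Context: Supernumbers: $\mathbb{R}_*=\mathbb{R}_*[0]\oplus\mathbb{R}_*[1]$ is the $\mathbb{Z}/2$-graded algebra over $\mathbb{R}$ with central unit $1$ of degree zero and countably infinitely many anticommuting generators $e_1,e_2,\dots$ of degree one (each element is a finite sum of finite products). Elements of $\mathbb{R}_*[0]$ are even (bosons), those of $\mathbb{R}_*[1]$ odd (fermions). The body $a_\#\in\mathbb{R}$ of $a$ is its constant term, and $a-a_\#$ is nilpotent. Real-analytic functions are extended to supernumbers by Taylor series under appropriate restrictions on the body. Inequalities between supernumbers are inequalities between their bodies. Super Minkowski space: $\mathbb{R}^{2,1|2}=\{(x_1,x_2,y\,|\,\phi,\psi): x_1,x_2,y\in\mathbb{R}_*[0],\ \phi,\psi\in\mathbb{R}_*[1]\}$ with the pairing $$\langle (x_1,x_2,y|\phi,\psi),(x_1',x_2',y'|\phi',\psi')\rangle=\tfrac12(x_1x_2'+x_1'x_2)-yy'+\phi\psi'+\phi'\psi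 .$$ The super hyperbolic plane is $\mathbb{H}_s=\{\mathbf x\in\mathbb{R}^{2,1|2}:\langle\mathbf x,\mathbf x\rangle=1,\ x_1+x_2>0\}$, with metric induced from the pairing (whose restriction to the classical hyperboloid is negative definite). The super hyperboloid of one sheet is $\mathbb{D}_s=\{\mathbf h\in\mathbb{R}^{2,1|2}:\langle\mathbf h,\mathbf h\rangle=-1\}$. Supergeodesics are the curves $L_{\mathbf u,\mathbf v}=\{\cosh s\,\mathbf u+\sinh s\,\mathbf v: s\in\mathbb{R}\}$ with $\mathbf u\in\mathbb{H}_s$, $\mathbf v\in\mathbb{D}_s$, $\langle\mathbf u,\mathbf v\rangle=0$, parametrized by arc length $s$. The distance $d(\mathbf X,\mathbf Y)$ between distinct points of $\mathbb{H}_s$ satisfies $\cosh d(\mathbf X,\mathbf Y)=\langle\mathbf X,\mathbf Y\rangle$, and the unit tangent vector at $\mathbf X$ to the supergeodesic from $\mathbf X$ to $\mathbf Y$ is $$\mathbf t_{\mathbf X\mathbf Y}=\frac{\mathbf Y-\langle\mathbf X,\mathbf Y\rangle\mathbf X}{\sqrt{\langle\mathbf X,\mathbf Y\rangle^2-1}}.$$ Supertriangle: three points of $\mathbb{H}_s$ not lying on a common supergeodesic determine a supertriangle, namely three supergeodesic segments with disjoint interiors meeting pairwise at the given points. The terminology of sides and opposite angles is the usual one, adopted from the bodies. The side lengths are $A=d(\mathbf B,\mathbf C)$, $B=d(\mathbf A,\mathbf C)$, $C=d(\mathbf A,\mathbf B)$. The angle $a$ at $\mathbf A$ is the angle between the unit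 tangent vectors at $\mathbf A$ to the two sides meeting there, so $\cos a=-\langle\mathbf t_{\mathbf A\mathbf B},\mathbf t_{\mathbf A\mathbf C}\rangle$ (the pairing being negative definite on tangent vectors at the level of bodies), and $\cos^2a+\sin^2a=1$; likewise for $b$ at $\mathbf B$ and $c$ at $\mathbf C$.
   Formalization: The bodies of the three points are also required not to lie on a common geodesic, since for coinciding bodies the unit tangent vectors are undefined, and for collinear bodies the angles may not exist and their sines are not determined. *)

theory Defs
  imports "HOL-Analysis.Analysis"
begin

section \<open>Supernumbers\<close>

text \<open>
  The coefficient function of a supernumber in the basis of ordered monomials: the finite set
  \<open>S = {i\<^sub>1 < \<dots> < i\<^sub>k}\<close> stands for the product of the generators with indices
  \<open>i\<^sub>1, \<dots>, i\<^sub>k\<close> in this order, and the empty set for the unit.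
\<close>

typedef supernum =
  "{f :: nat set \<Rightarrow> real. finite {S. f S \<noteq> 0} \<and> (\<forall>S. f S \<noteq> 0 \<longrightarrow> finite S)}"
  morphisms coeff Abs_supernum
  by (rule exI[of _ "\<lambda>_. 0"]) simp

setup_lifting type_definition_supernum

lemma supernum_eqI: "(\<And>S. coeff a S = coeff b S) \<Longrightarrow> a = b"
  by (simp add: coeff_inject[symmetric] fun_eq_iff)

lemma finite_supp: "finite {S. coeff a S \<noteq> 0}"
  using coeff[of a] by simp

lemma finite_of_coeff: "coeff a S \<noteq> 0 \<Longrightarrow> finite S"
  using coeff[of a] by simp

lemma coeff_infinite: "infinite S \<Longrightarrow> coeff a S = 0"
  using finite_of_coeff by blast

text \<open>The sign that sorts the concatenation of two ordered monomials.\<close>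

definition gsign :: "nat set \<Rightarrow> nat set \<Rightarrow> real" where
  "gsign S T = (-1) ^ card {(i, j). i \<in> S \<and> j \<in> T \<and> j < i}"

lemma gsign_empty [simp]: "gsign {} T = 1" "gsign S {} = 1"
  by (simp_all add: gsign_def)

lemma finite_inversions:
  assumes "finite S" "finite T"
  shows "finite {(i, j). i \<in> S \<and> j \<in> T \<and> j < (i::nat)}"
  by (rule finite_subset[of _ "S \<times> T"]) (use assms in auto)

lemma gsign_Un_left:
  assumes "finite S" "finite T" "finite U" "S \<inter> T = {}"
  shows "gsign (S \<union> T) U = gsign S U * gsign T U"
proof -
  have "{(i, j). i \<in> S \<union> T \<and> j \<in> U \<and> j < i} =
      {(i, j). i \<in> S \<and> j \<in> U \<and> j < i} \<union> {(i, j). i \<in> T \<and> j \<in> U \<and> j < i}"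
    by auto
  then have "card {(i, j). i \<in> S \<union> T \<and> j \<in> U \<and> j < i} =
      card {(i, j). i \<in> S \<and> j \<in> U \<and> j < i} + card {(i, j). i \<in> T \<and> j \<in> U \<and> j < i}"
    using assms by (auto intro!: card_Un_disjoint finite_inversions)
  then show ?thesis
    by (simp add: gsign_def power_add)
qed

lemma gsign_Un_right:
  assumes "finite S" "finite T" "finite U" "T \<inter> U = {}"
  shows "gsign S (T \<union> U) = gsign S T * gsign S U"
proof -
  have "{(i, j). i \<in> S \<and> j \<in> T \<union> U \<and> j < i} =
      {(i, j). i \<in> S \<and> j \<in> T \<and> j < i} \<union> {(i, j). i \<in> S \<and> j \<in> U \<and> j < i}"
    by auto
  then have "card {(i, j). i \<in> S \<and> j \<in> T \<union> U \<and> j < i} =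
      card {(i, j). i \<in> S \<and> j \<in> T \<and> j < i} + card {(i, j). i \<in> S \<and> j \<in> U \<and> j < i}"
    using assms by (auto intro!: card_Un_disjoint finite_inversions)
  then show ?thesis
    by (simp add: gsign_def power_add)
qed

instantiation supernum :: "{zero, one, plus, minus, uminus, times, scaleR, inverse}"
begin

lift_definition zero_supernum :: supernum is "\<lambda>_. 0" by simp

lift_definition one_supernum :: supernum is "\<lambda>S. if S = {} then 1 else 0" by auto

lift_definition plus_supernum :: "supernum \<Rightarrow> supernum \<Rightarrow> supernum" is "\<lambda>f g S. f S + g S"
proof -
  fix f g :: "nat set \<Rightarrow> real"
  assume f: "finite {S. f S \<noteq> 0} \<and> (\<forall>S. f S \<noteq> 0 \<longrightarrow> finite S)"
    and g: "finite {S. g S \<noteq> 0} \<and> (\<forall>S. g S \<noteq> 0 \<longrightarrow> finite S)"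
  have "finite {S. f S + g S \<noteq> 0}"
    by (rule finite_subset[of _ "{S. f S \<noteq> 0} \<union> {S. g S \<noteq> 0}"]) (use f g in auto)
  moreover have "\<forall>S. f S + g S \<noteq> 0 \<longrightarrow> finite S"
    using f g by force
  ultimately show "finite {S. f S + g S \<noteq> 0} \<and> (\<forall>S. f S + g S \<noteq> 0 \<longrightarrow> finite S)"
    by simp
qed

lift_definition uminus_supernum :: "supernum \<Rightarrow> supernum" is "\<lambda>f S. - f S" by simp

definition minus_supernum :: "supernum \<Rightarrow> supernum \<Rightarrow> supernum" where
  "a - b = a + - (b :: supernum)"

lift_definition scaleR_supernum :: "real \<Rightarrow> supernum \<Rightarrow> supernum" is "\<lambda>r f S. r * f S"
  by (auto intro: rev_finite_subset)

lift_definition times_supernum :: "supernum \<Rightarrow> supernum \<Rightarrow> supernum" is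
  "\<lambda>f g S. \<Sum>T\<in>Pow S. gsign T (S - T) * f T * g (S - T)"
proof -
  fix f g :: "nat set \<Rightarrow> real"
  assume f: "finite {S. f S \<noteq> 0} \<and> (\<forall>S. f S \<noteq> 0 \<longrightarrow> finite S)"
    and g: "finite {S. g S \<noteq> 0} \<and> (\<forall>S. g S \<noteq> 0 \<longrightarrow> finite S)"
  let ?h = "\<lambda>S. \<Sum>T\<in>Pow S. gsign T (S - T) * f T * g (S - T)"
  have sub: "{S. ?h S \<noteq> 0} \<subseteq> (\<lambda>(T, U). T \<union> U) ` ({T. f T \<noteq> 0} \<times> {U. g U \<noteq> 0})"
  proof
    fix S assume "S \<in> {S. ?h S \<noteq> 0}"
    then obtain T where "T \<in> Pow S" "gsign T (S - T) * f T * g (S - T) \<noteq> 0"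
      by (auto elim: sum.not_neutral_contains_not_neutral)
    then have "T \<union> (S - T) = S" "f T \<noteq> 0" "g (S - T) \<noteq> 0"
      by auto
    then show "S \<in> (\<lambda>(T, U). T \<union> U) ` ({T. f T \<noteq> 0} \<times> {U. g U \<noteq> 0})"
      by (intro image_eqI[of _ _ "(T, S - T)"]) auto
  qed
  have "finite {S. ?h S \<noteq> 0}"
    by (rule finite_subset[OF sub]) (use f g in auto)
  moreover have "\<forall>S. ?h S \<noteq> 0 \<longrightarrow> finite S"
    using sum.infinite finite_Pow_iff by blast
  ultimately show "finite {S. ?h S \<noteq> 0} \<and> (\<forall>S. ?h S \<noteq> 0 \<longrightarrow> finite S)"
    by simp
qed

text \<open>The inverse of a unit; a supernumber that is not a unit has inverse \<open>0\<close>.\<close>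

definition inverse_supernum :: "supernum \<Rightarrow> supernum" where
  "inverse_supernum a =
    (if \<exists>b. a * b = 1 \<and> b * a = 1 then THE b. a * b = 1 \<and> b * a = 1 else 0)"

definition divide_supernum :: "supernum \<Rightarrow> supernum \<Rightarrow> supernum" where
  "divide_supernum a b = a * inverse b"

instance ..

end

lemmas coeff_zero [simp] = zero_supernum.rep_eq[THEN fun_cong]
lemmas coeff_one = one_supernum.rep_eq[THEN fun_cong]
lemmas coeff_add [simp] = plus_supernum.rep_eq[THEN fun_cong]
lemmas coeff_uminus [simp] = uminus_supernum.rep_eq[THEN fun_cong]
lemmas coeff_scaleR [simp] = scaleR_supernum.rep_eq[THEN fun_cong]
lemmas coeff_mult = times_supernum.rep_eq[THEN fun_cong]

lemma coeff_minus [simp]: "coeff (a - b) S = coeff a S - coeff b S"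
  by (simp add: minus_supernum_def)

lemma supernum_mult_assoc: "(a * b) * c = a * (b * (c :: supernum))"
proof (rule supernum_eqI)
  fix S
  show "coeff ((a * b) * c) S = coeff (a * (b * c)) S"
  proof (cases "finite S")
    case False
    then show ?thesis by (simp add: coeff_infinite)
  next
    case fin: True
    let ?s = "\<lambda>T U V. gsign T U * gsign T V * gsign U V * coeff a T * coeff b U * coeff c V"
    have "coeff ((a * b) * c) S =
        (\<Sum>T\<in>Pow S. \<Sum>U\<in>Pow T. ?s U (T - U) (S - T))"
      unfolding coeff_mult sum_distrib_left sum_distrib_right
    proof (intro sum.cong refl)
      fix T U assume "T \<in> Pow S" "U \<in> Pow T"
      then have "finite T" "finite U" "U \<union> (T - U) = T"
        using fin by (auto intro: finite_subset)
      then have "gsign T (S - T) = gsign U (S - T) * gsign (T - U) (S - T)"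
        using gsign_Un_left[of U "T - U" "S - T"] fin by auto
      then show "gsign T (S - T) * (gsign U (T - U) * coeff a U * coeff b (T - U)) * coeff c (S - T)
          = ?s U (T - U) (S - T)"
        by (simp add: mult_ac)
    qed
    also have "\<dots> = (\<Sum>(T, U)\<in>(SIGMA T:Pow S. Pow T). ?s U (T - U) (S - T))"
      using fin by (subst sum.Sigma) (auto intro: finite_subset)
    also have "\<dots> = (\<Sum>(U, V)\<in>(SIGMA U:Pow S. Pow (S - U)). ?s U V (S - U - V))"
    proof (rule sum.reindex_bij_witness[of _ "\<lambda>(U, V). (U \<union> V, U)" "\<lambda>(T, U). (U, T - U)"], goal_cases)
      case (5 p)
      obtain T U where p: "p = (T, U)" by fastforce
      with 5 have "S - U - (T - U) = S - T" by auto
      with p show ?case by simp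
    qed fastforce+
    also have "\<dots> = (\<Sum>U\<in>Pow S. \<Sum>V\<in>Pow (S - U). ?s U V (S - U - V))"
      using fin by (subst sum.Sigma) (auto intro: finite_subset)
    also have "\<dots> = coeff (a * (b * c)) S"
      unfolding coeff_mult sum_distrib_left sum_distrib_right
    proof (intro sum.cong refl)
      fix U V assume "U \<in> Pow S" "V \<in> Pow (S - U)"
      then have "finite V" "finite U" "V \<union> (S - U - V) = S - U"
        using fin by (auto intro: finite_subset)
      then have "gsign U (S - U) = gsign U V * gsign U (S - U - V)"
        using gsign_Un_right[of U V "S - U - V"] fin by auto
      then show "?s U V (S - U - V) = gsign U (S - U) * coeff a U *
          (gsign V (S - U - V) * coeff b V * coeff c (S - U - V))"
        by (simp add: mult_ac)
    qed
    finally show ?thesis .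
  qed
qed

lemma supernum_one_mult: "1 * a = (a :: supernum)"
proof (rule supernum_eqI)
  fix S
  have "(\<Sum>T\<in>Pow S. gsign T (S - T) * coeff 1 T * coeff a (S - T)) = coeff a S"
    if "finite S"
    using that by (subst sum.remove[of _ "{}"]) (auto simp: coeff_one intro!: sum.neutral)
  then show "coeff (1 * a) S = coeff a S"
    by (cases "finite S") (simp_all add: coeff_mult coeff_infinite)
qed

lemma supernum_mult_one: "a * 1 = (a :: supernum)"
proof (rule supernum_eqI)
  fix S
  have "(\<Sum>T\<in>Pow S. gsign T (S - T) * coeff a T * coeff 1 (S - T)) = coeff a S"
    if "finite S"
    using that by (subst sum.remove[of _ S]) (auto simp: coeff_one intro!: sum.neutral split: if_splits)
  then show "coeff (a * 1) S = coeff a S"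
    by (cases "finite S") (simp_all add: coeff_mult coeff_infinite)
qed

instance supernum :: real_algebra_1
proof
  fix a b c :: supernum and r s :: real
  show "a + b + c = a + (b + c)" "a + b = b + a" "0 + a = a" "- a + a = 0" "a - b = a + - b"
    "r *\<^sub>R (a + b) = r *\<^sub>R a + r *\<^sub>R b" "(r + s) *\<^sub>R a = r *\<^sub>R a + s *\<^sub>R a"
    "r *\<^sub>R s *\<^sub>R a = (r * s) *\<^sub>R a" "1 *\<^sub>R a = a"
    by (auto intro!: supernum_eqI simp: algebra_simps)
  show "a * b * c = a * (b * c)" "1 * a = a" "a * 1 = a"
    by (rule supernum_mult_assoc supernum_one_mult supernum_mult_one)+
  show "(a + b) * c = a * c + b * c" "a * (b + c) = a * b + a * c"
    by (auto intro!: supernum_eqI simp: coeff_mult algebra_simps sum.distrib)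
  show "r *\<^sub>R a * b = r *\<^sub>R (a * b)" "a * r *\<^sub>R b = r *\<^sub>R (a * b)"
    by (auto intro!: supernum_eqI simp: coeff_mult sum_distrib_left mult_ac)
  have "coeff (0 :: supernum) {} \<noteq> coeff 1 {}"
    by (simp add: coeff_one)
  then show "(0 :: supernum) \<noteq> 1"
    by metis
qed

definition bosons :: "supernum set" where
  "bosons = {a. \<forall>S. coeff a S \<noteq> 0 \<longrightarrow> even (card S)}"

definition fermions :: "supernum set" where
  "fermions = {a. \<forall>S. coeff a S \<noteq> 0 \<longrightarrow> odd (card S)}"

definition body :: "supernum \<Rightarrow> real" where
  "body a = coeff a {}"

definition soul :: "supernum \<Rightarrow> supernum" where
  "soul a = a - of_real (body a)"

lift_definition gen :: "nat \<Rightarrow> supernum" is "\<lambda>i S. if S = {i} then 1 else 0" by auto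

lemma coeff_gen_mult:
  "coeff (gen i * gen j) S = (if i \<noteq> j \<and> S = {i, j} then gsign {i} {j} else 0)"
proof (cases "finite S")
  case False
  then show ?thesis by (auto simp: coeff_infinite)
next
  case True
  have "coeff (gen i * gen j) S =
      (\<Sum>T\<in>Pow S. if T = {i} then (if S - {i} = {j} then gsign {i} {j} else 0) else 0)"
    unfolding coeff_mult by (intro sum.cong) (auto simp: gen.rep_eq)
  also have "\<dots> = (if {i} \<in> Pow S then (if S - {i} = {j} then gsign {i} {j} else 0) else 0)"
    using True by (simp only: sum.delta' sum.delta finite_Pow_iff)
  also have "\<dots> = (if i \<noteq> j \<and> S = {i, j} then gsign {i} {j} else 0)"
    by auto
  finally show ?thesis .
qed

lemma gen_anticommute: "gen i * gen j = - (gen j * gen i)"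
proof -
  have "gsign {i} {j} = - gsign {j} {i}" if "i \<noteq> j"
  proof -
    have "{(k, l). k \<in> {m} \<and> l \<in> {n} \<and> l < k} = (if n < m then {(m, n)} else {})"
      for m n :: nat by auto
    then have "gsign {m} {n} = (if n < m then -1 else 1)" for m n
      unfolding gsign_def by simp
    then show ?thesis using that by auto
  qed
  then show ?thesis
    by (intro supernum_eqI) (auto simp: coeff_gen_mult insert_commute)
qed

lemma coeff_soul: "coeff (soul a) S = (if S = {} then 0 else coeff a S)"
  by (simp add: soul_def body_def of_real_def coeff_one)

lemma soul_nilpotent: "\<exists>N. \<forall>n\<ge>N. soul a ^ n = 0"
proof -
  define V where "V = \<Union>{S. coeff a S \<noteq> 0}"
  have V: "finite V"
    unfolding V_def by (rule finite_Union) (auto intro: finite_supp finite_of_coeff)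
  have supp: "T \<subseteq> V" if "coeff a T \<noteq> 0" for T
    using that unfolding V_def by blast
  have *: "coeff (soul a ^ n) S \<noteq> 0 \<Longrightarrow> S \<subseteq> V \<and> n \<le> card S" for n S
  proof (induction n arbitrary: S)
    case 0
    then show ?case by (simp add: coeff_one split: if_splits)
  next
    case (Suc n)
    have fin: "finite S"
      using Suc.prems by (rule finite_of_coeff)
    have "(\<Sum>T\<in>Pow S. gsign T (S - T) * coeff (soul a) T * coeff (soul a ^ n) (S - T)) \<noteq> 0"
      using Suc.prems by (simp only: power_Suc coeff_mult not_False_eq_True)
    then obtain T where "T \<in> Pow S"
      and ne: "gsign T (S - T) * coeff (soul a) T * coeff (soul a ^ n) (S - T) \<noteq> 0"
      by (rule sum.not_neutral_contains_not_neutral)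
    then have T: "T \<subseteq> S" and "T \<noteq> {}" "T \<subseteq> V"
      using supp by (auto simp: coeff_soul split: if_splits)
    have IH: "S - T \<subseteq> V \<and> n \<le> card (S - T)"
      using ne by (intro Suc.IH) simp
    have "card (S - T) < card S"
      using T \<open>T \<noteq> {}\<close> fin by (intro psubset_card_mono) auto
    then show ?case
      using IH \<open>T \<subseteq> V\<close> by auto
  qed
  have "soul a ^ n = 0" if n: "n \<ge> Suc (card V)" for n
  proof (rule supernum_eqI, rule ccontr)
    fix S
    assume "coeff (soul a ^ n) S \<noteq> coeff 0 S"
    then have "S \<subseteq> V \<and> n \<le> card S"
      by (intro *) simp
    then show False
      using card_mono[OF V, of S] n by linarith
  qed
  then show ?thesis by blast
qed

text \<open>
  The Taylor series of a real function at the body. By \<open>soul_nilpotent\<close> it has finitely many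
  nonzero terms. Only meaningful for even arguments whose body lies in the domain of
  analyticity of the function.
\<close>

definition superext :: "(real \<Rightarrow> real) \<Rightarrow> supernum \<Rightarrow> supernum" where
  "superext f a =
    (\<Sum>n | soul a ^ n \<noteq> 0. ((deriv ^^ n) f (body a) / fact n) *\<^sub>R soul a ^ n)"

section \<open>Super Minkowski space and the super hyperbolic plane\<close>

text \<open>The components are, in this order, \<open>x\<^sub>1\<close>, \<open>x\<^sub>2\<close>, \<open>y\<close>, \<open>\<phi>\<close>, \<open>\<psi>\<close>.\<close>

type_synonym svec = "supernum \<times> supernum \<times> supernum \<times> supernum \<times> supernum"

definition super_minkowski :: "svec set" where
  "super_minkowski = bosons \<times> bosons \<times> bosons \<times> fermions \<times> fermions"

fun pairing :: "svec \<Rightarrow> svec \<Rightarrow> supernum" where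
  "pairing (x1, x2, y, \<phi>, \<psi>) (x1', x2', y', \<phi>', \<psi>') =
    (1 / 2) *\<^sub>R (x1 * x2' + x1' * x2) - y * y' + \<phi> * \<psi>' + \<phi>' * \<psi>"

fun smult :: "supernum \<Rightarrow> svec \<Rightarrow> svec" where
  "smult c (x1, x2, y, \<phi>, \<psi>) = (c * x1, c * x2, c * y, c * \<phi>, c * \<psi>)"

definition super_hyperbolic_plane :: "svec set" where
  "super_hyperbolic_plane =
    {X \<in> super_minkowski. pairing X X = 1 \<and> body (fst X + fst (snd X)) > 0}"

definition super_hyperboloid :: "svec set" where
  "super_hyperboloid = {h \<in> super_minkowski. pairing h h = - 1}"

definition supergeodesic :: "svec \<Rightarrow> svec \<Rightarrow> svec set" where
  "supergeodesic u v =
    range (\<lambda>s :: real. smult (of_real (cosh s)) u + smult (of_real (sinh s)) v)"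

definition supergeodesics :: "svec set set" where
  "supergeodesics =
    {supergeodesic u v | u v.
      u \<in> super_hyperbolic_plane \<and> v \<in> super_hyperboloid \<and> pairing u v = 0}"

definition body_point :: "svec \<Rightarrow> svec" where
  "body_point = (\<lambda>(x1, x2, y, \<phi>, \<psi>).
    (of_real (body x1), of_real (body x2), of_real (body y),
     of_real (body \<phi>), of_real (body \<psi>)))"

text \<open>
  The last conjunct is the restriction on the bodies under which the sides and angles are
  defined: the bodies of the vertices are the vertices of a nondegenerate hyperbolic triangle.
  It cannot be dropped: if two of the bodies agree, then the pairing of the two points
  has body \<open>1\<close> and there is no unit tangent vector from one to the other; if the bodies lie on a
  geodesic, then the cosines of the angles have body \<open>1\<close> or \<open>-1\<close>, so that the sines are
  nilpotent and not determined, not even up to sign.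
\<close>

definition supertriangle :: "svec \<Rightarrow> svec \<Rightarrow> svec \<Rightarrow> bool" where
  "supertriangle X Y Z \<longleftrightarrow>
    {X, Y, Z} \<subseteq> super_hyperbolic_plane \<and>
    \<not> (\<exists>L\<in>supergeodesics. {X, Y, Z} \<subseteq> L) \<and>
    \<not> (\<exists>L\<in>supergeodesics. {body_point X, body_point Y, body_point Z} \<subseteq> L)"

definition sdist :: "svec \<Rightarrow> svec \<Rightarrow> supernum" where
  "sdist X Y = (THE d. d \<in> bosons \<and> body d > 0 \<and> superext cosh d = pairing X Y)"

definition unit_tangent :: "svec \<Rightarrow> svec \<Rightarrow> svec" where
  "unit_tangent X Y =
    smult (1 / superext sqrt ((pairing X Y)\<^sup>2 - 1)) (Y - smult (pairing X Y) X)"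

text \<open>The angle at \<open>X\<close> between the sides to \<open>Y\<close> and to \<open>Z\<close>.\<close>

definition sangle :: "svec \<Rightarrow> svec \<Rightarrow> svec \<Rightarrow> supernum" where
  "sangle X Y Z = (THE \<theta>. \<theta> \<in> bosons \<and> 0 < body \<theta> \<and> body \<theta> < pi \<and>
    superext cos \<theta> = - pairing (unit_tangent X Y) (unit_tangent X Z))"

end

theory Submission
  imports Defs
begin

text \<open>
  Everything reduces to identities in the commutative algebra of even supernumbers. Taylor
  extension is evaluation of a formal power series at the nilpotent soul, which is a ring
  homomorphism compatible with composition. Hence real identities such as
  \<open>cosh\<^sup>2 - sinh\<^sup>2 = 1\<close> carry over, compositional inverses of power series show
  that lengths and angles exist and are unique, and an even square root is determined by the
  sign of its body. Let \<open>p, q, r\<close> be the pairings of the three vertices and \<open>D\<close> their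
  Gram determinant. Then the hyperbolic cosines of the sides are \<open>p, q, r\<close>, and the cosine and sine
  of the angle between the first two sides are \<open>(pq - r) / \<surd>(p\<^sup>2 - 1)\<surd>(q\<^sup>2 - 1)\<close> and
  \<open>\<surd>D / \<surd>(p\<^sup>2 - 1)\<surd>(q\<^sup>2 - 1)\<close>, so that the three laws are polynomial identities.
  The roots make sense because the bodies of the vertices are not collinear, which forces
  \<open>p, q, r > 1\<close> and \<open>D > 0\<close> on bodies.
\<close>

section \<open>Power series at nilpotent elements\<close>

text \<open>Only nonzero powers are summed, in the same form as in \<open>superext\<close>. For
  nilpotent \<open>n\<close> the index set is finite.\<close>

definition fps_eval :: "real fps \<Rightarrow> 'a \<Rightarrow> 'a :: real_algebra_1" where
  "fps_eval F n = (\<Sum>k | n ^ k \<noteq> 0. fps_nth F k *\<^sub>R n ^ k)"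

lemma power_eq_zero_mono:
  fixes n :: "'a :: semiring_1"
  assumes "n ^ N = 0" "N \<le> k"
  shows "n ^ k = 0"
  using assms by (metis le_add_diff_inverse power_add mult_zero_left)

text \<open>Any exponent \<open>N\<close> that kills \<open>n\<close> may serve as the bound, least
  or not, so different series can be summed over a common range.\<close>

lemma fps_eval_eq_sum:
  assumes "n ^ N = 0"
  shows "fps_eval F n = (\<Sum>k<N. fps_nth F k *\<^sub>R n ^ k)"
  unfolding fps_eval_def
proof (rule sum.mono_neutral_left)
  show "{k. n ^ k \<noteq> 0} \<subseteq> {..<N}"
    using power_eq_zero_mono[OF assms] by (auto simp flip: not_less)
qed auto

lemma fps_eval_const: "n ^ N = 0 \<Longrightarrow> fps_eval (fps_const c) n = of_real c"
  by (subst fps_eval_eq_sum[of n "Suc N"])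
    (simp_all add: sum.lessThan_Suc_shift of_real_def del: sum.lessThan_Suc)

lemma fps_eval_X: "n ^ N = 0 \<Longrightarrow> fps_eval fps_X n = n"
  \<comment> \<open>Raising the bound by two lets the terms of index 0 and 1 be split off whatever
    \<open>N\<close> is.\<close>
  by (subst fps_eval_eq_sum[of n "Suc (Suc N)"])
    (simp_all add: sum.lessThan_Suc_shift fps_X_def del: sum.lessThan_Suc)

lemma fps_eval_add: "n ^ N = 0 \<Longrightarrow> fps_eval (F + G) n = fps_eval F n + fps_eval G n"
  by (simp add: fps_eval_eq_sum scaleR_add_left sum.distrib)

lemma fps_eval_diff: "n ^ N = 0 \<Longrightarrow> fps_eval (F - G) n = fps_eval F n - fps_eval G n"
  by (simp add: fps_eval_eq_sum scaleR_diff_left sum_subtractf)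

lemma fps_eval_mult:
  assumes "n ^ N = 0"
  shows "fps_eval (F * G) n = fps_eval F n * fps_eval G n"
proof -
  let ?g = "\<lambda>i j. (fps_nth F i * fps_nth G j) *\<^sub>R n ^ (i + j)"
  have "fps_eval F n * fps_eval G n = (\<Sum>i<N. \<Sum>j<N. ?g i j)"
    by (simp add: fps_eval_eq_sum[OF assms] sum_product power_add mult_ac)
  also have "\<dots> = (\<Sum>(i, j)\<in>{..<N} \<times> {..<N}. ?g i j)"
    by (simp add: sum.cartesian_product)
  \<comment> \<open>The square and the triangle differ only in terms with
    \<open>i + j \<ge> N\<close>, which vanish.\<close>
  also have "\<dots> = (\<Sum>(i, j)\<in>{(i, j). i + j < N}. ?g i j)"
    by (rule sum.mono_neutral_right)
      (auto simp flip: not_le intro: power_eq_zero_mono[OF assms])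
  also have "\<dots> = (\<Sum>k<N. \<Sum>i\<le>k. ?g i (k - i))"
    by (rule sum.triangle_reindex)
  also have "\<dots> = fps_eval (F * G) n"
    unfolding fps_eval_eq_sum[OF assms]
    by (auto intro!: sum.cong simp: fps_mult_nth scaleR_sum_left atLeast0AtMost)
  finally show ?thesis ..
qed

lemma fps_eval_power:
  assumes "n ^ N = 0"
  shows "fps_eval (F ^ k) n = fps_eval F n ^ k"
proof (induction k)
  case 0
  show ?case
    using fps_eval_const[OF assms, of 1] by simp
qed (simp add: fps_eval_mult[OF assms])

text \<open>\<open>G ^ N\<close> has no coefficients below \<open>N\<close>, and the powers of
  \<open>n\<close> from \<open>N\<close> on vanish. Thus one exponent bounds both \<open>n\<close>
  and the value of \<open>G\<close> at \<open>n\<close>.\<close>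

lemma fps_eval_nilpotent:
  assumes "n ^ N = 0" "fps_nth G 0 = 0"
  shows "fps_eval G n ^ N = 0"
proof -
  have "fps_eval (G ^ N) n = 0"
    using startsby_zero_power_prefix[OF assms(2)]
    by (simp add: fps_eval_eq_sum[OF assms(1)])
  then show ?thesis
    by (simp add: fps_eval_power[OF assms(1)])
qed

lemma fps_eval_compose:
  assumes n: "n ^ N = 0" and G: "fps_nth G 0 = 0"
  shows "fps_eval (F oo G) n = fps_eval F (fps_eval G n)"
proof -
  have "fps_eval F (fps_eval G n) = (\<Sum>i<N. \<Sum>k<N. (fps_nth F i * fps_nth (G ^ i) k) *\<^sub>R n ^ k)"
    by (simp add: fps_eval_eq_sum[OF fps_eval_nilpotent[OF n G]] fps_eval_eq_sum[OF n, of "G ^ _"]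
        scaleR_sum_right flip: fps_eval_power[OF n])
  also have "\<dots> = (\<Sum>k<N. \<Sum>i<N. (fps_nth F i * fps_nth (G ^ i) k) *\<^sub>R n ^ k)"
    by (rule sum.swap)
  \<comment> \<open>As \<open>G ^ i\<close> starts in degree \<open>i\<close>, the terms with
    \<open>k < i\<close> vanish and the inner sum becomes the coefficient of the
    composition.\<close>
  also have "\<dots> = (\<Sum>k<N. \<Sum>i=0..k. (fps_nth F i * fps_nth (G ^ i) k) *\<^sub>R n ^ k)"
    using startsby_zero_power_prefix[OF G]
    by (intro sum.cong refl sum.mono_neutral_right) auto
  also have "\<dots> = fps_eval (F oo G) n"
    by (simp add: fps_eval_eq_sum[OF n] fps_compose_nth scaleR_sum_left)
  finally show ?thesis ..
qed

text \<open>A formal inverse function theorem: \<open>fps_inv G\<close> is a two-sided compositional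
  inverse. One side gives existence, the other uniqueness among nilpotents; a competing
  \<open>n\<close> comes with its own exponent \<open>M\<close>.\<close>

lemma fps_eval_ex1_preimage:
  assumes m: "m ^ N = 0" and G: "fps_nth G 0 = 0" "fps_nth G 1 \<noteq> 0"
  shows "fps_eval (fps_inv G) m ^ N = 0" "fps_eval G (fps_eval (fps_inv G) m) = m"
    and "n ^ M = 0 \<Longrightarrow> fps_eval G n = m \<Longrightarrow> n = fps_eval (fps_inv G) m"
proof -
  have inv0: "fps_nth (fps_inv G) 0 = 0"
    by (simp add: fps_inv_def)
  show "fps_eval (fps_inv G) m ^ N = 0"
    by (rule fps_eval_nilpotent[OF m inv0])
  show "fps_eval G (fps_eval (fps_inv G) m) = m"
    using fps_eval_compose[OF m inv0, of G] fps_inv_right[OF G] fps_eval_X[OF m] by simp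
  show "n = fps_eval (fps_inv G) m" if "n ^ M = 0" "fps_eval G n = m"
    using fps_eval_compose[OF that(1) G(1), of "fps_inv G"] fps_inv[OF G] fps_eval_X[OF that(1)]
      that(2) by simp
qed

section \<open>Formal Taylor series of real functions\<close>

definition taylor_fps :: "(real \<Rightarrow> real) \<Rightarrow> real \<Rightarrow> real fps" where
  "taylor_fps f x = Abs_fps (\<lambda>n. (deriv ^^ n) f x / fact n)"

lemma taylor_fps_nth_0: "fps_nth (taylor_fps f x) 0 = f x"
  by (simp add: taylor_fps_def)

lemma taylor_fps_nth_1: "fps_nth (taylor_fps f x) 1 = deriv f x"
  by (simp add: taylor_fps_def)

text \<open>Bookkeeping of iterates of the total operator \<open>deriv\<close>: the factor
  \<open>Suc n\<close> of the formal derivative cancels against the factorial.\<close>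

lemma fps_deriv_taylor_fps: "fps_deriv (taylor_fps f x) = taylor_fps (deriv f) x"
proof (rule fps_ext)
  fix n
  have "(deriv ^^ Suc n) f x = (deriv ^^ n) (deriv f) x"
    by (simp only: funpow_Suc_right o_apply)
  then show "fps_nth (fps_deriv (taylor_fps f x)) n = fps_nth (taylor_fps (deriv f) x) n"
    by (simp add: taylor_fps_def del: funpow.simps of_nat_Suc)
qed

text \<open>\<open>deriv_minus\<close> asks for differentiability, hence the hypothesis on all
  iterates. The lemma serves the series of \<open>deriv cos\<close>.\<close>

lemma taylor_fps_uminus: "taylor_fps (\<lambda>x. - f x) x = - taylor_fps f x"
  if "\<And>n y. (deriv ^^ n) f field_differentiable at y"
proof -
  have "(deriv ^^ n) (\<lambda>x. - f x) = (\<lambda>x. - (deriv ^^ n) f x)" for n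
    by (induction n) (use that in \<open>auto intro!: ext deriv_minus\<close>)
  then show ?thesis
    by (intro fps_ext) (simp add: taylor_fps_def)
qed

lemma deriv_cosh: "deriv cosh = (sinh :: real \<Rightarrow> real)"
  and deriv_sinh: "deriv sinh = (cosh :: real \<Rightarrow> real)"
  and deriv_cos: "deriv cos = (\<lambda>x :: real. - sin x)"
  and deriv_sin: "deriv sin = (cos :: real \<Rightarrow> real)"
  by (auto intro!: ext DERIV_imp_deriv derivative_eq_intros)

text \<open>The formal derivative of the left side is zero, so the series is constant, and its
  constant coefficient is the real identity at \<open>x\<close>.\<close>

lemma cosh_sinh_taylor_fps:
  "taylor_fps cosh x ^ 2 - taylor_fps sinh x ^ 2 = 1"
proof -
  let ?F = "taylor_fps cosh x ^ 2 - taylor_fps sinh x ^ 2"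
  have "fps_deriv ?F = 0"
    by (simp add: power2_eq_square fps_deriv_taylor_fps deriv_cosh deriv_sinh algebra_simps)
  then have "?F = fps_const (fps_nth ?F 0)"
    by (simp only: fps_deriv_eq_0_iff)
  also have "fps_nth ?F 0 = 1"
    by (simp add: power2_eq_square taylor_fps_nth_0 hyperbolic_pythagoras[unfolded power2_eq_square])
  finally show ?thesis by simp
qed

lemma cos_sin_taylor_fps:
  "taylor_fps cos x ^ 2 + taylor_fps sin x ^ 2 = 1"
proof -
  let ?F = "taylor_fps cos x ^ 2 + taylor_fps sin x ^ 2"
  \<comment> \<open>The iterated derivatives of \<open>sin\<close> cycle through four differentiable
    functions, which provides the hypothesis of \<open>taylor_fps_uminus\<close>.\<close>
  have "(deriv ^^ n) sin \<in> {sin, cos, \<lambda>x :: real. - sin x, \<lambda>x. - cos x}" for n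
  proof (induction n)
    case (Suc n)
    have "deriv (\<lambda>x :: real. - sin x) = (\<lambda>x. - cos x)" "deriv (\<lambda>x :: real. - cos x) = sin"
      by (auto intro!: ext DERIV_imp_deriv derivative_eq_intros)
    with Suc show ?case
      by (auto simp: deriv_sin deriv_cos)
  qed simp
  then have "taylor_fps (\<lambda>x. - sin x) x = - taylor_fps sin x"
    by (intro taylor_fps_uminus)
      (metis (no_types) insertE singletonD field_differentiable_within_sin
        field_differentiable_within_cos field_differentiable_minus)
  then have "fps_deriv ?F = 0"
    by (simp add: power2_eq_square fps_deriv_taylor_fps deriv_cos deriv_sin algebra_simps)
  then have "?F = fps_const (fps_nth ?F 0)"
    by (simp only: fps_deriv_eq_0_iff)
  also have "fps_nth ?F 0 = 1"
    by (simp add: power2_eq_square taylor_fps_nth_0)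
  finally show ?thesis by simp
qed

text \<open>\<open>((1/2) gchoose n) * fact n\<close> is the falling factorial of
  \<open>1/2\<close>. The point stays arbitrary in the induction because differentiating requires
  the formula on a neighbourhood.\<close>

lemma higher_deriv_sqrt:
  "0 < x \<Longrightarrow> (deriv ^^ n) sqrt x = ((1/2) gchoose n) * fact n * x powr (1/2 - n)"
proof (induction n arbitrary: x)
  case (Suc n)
  have "(deriv ^^ Suc n) sqrt x = deriv (\<lambda>y. ((1/2) gchoose n) * fact n * y powr (1/2 - n)) x"
    unfolding funpow.simps(2) o_apply
  proof (rule deriv_cong_ev)
    have "eventually (\<lambda>y. y > 0) (nhds x)"
      using Suc.prems by (intro eventually_nhds_in_open[of "{0<..}", simplified]) auto
    then show "\<forall>\<^sub>F y in nhds x. (deriv ^^ n) sqrt y = ((1/2) gchoose n) * fact n * y powr (1/2 - n)"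
      by eventually_elim (rule Suc.IH)
  qed simp
  also have "\<dots> = ((1/2) gchoose n) * fact n * ((1/2 - n) * x powr (1/2 - n - 1))"
    using Suc.prems by (intro DERIV_imp_deriv DERIV_cmult has_real_derivative_powr)
  also have "\<dots> = ((1/2) gchoose Suc n) * fact (Suc n) * x powr (1/2 - Suc n)"
  proof -
    have eq: "(1/2 - real n) * ((1/2) gchoose n) = Suc n * ((1/2) gchoose Suc n)"
      using gbinomial_mult_1[of "1/2 :: real" n] by (simp add: algebra_simps)
    have "((1/2) gchoose n) * fact n * ((1/2 - n) * c) = fact n * c * ((1/2 - n) * ((1/2) gchoose n))"
      for c :: real
      by (simp only: mult_ac)
    also have "\<dots> c = ((1/2) gchoose Suc n) * fact (Suc n) * c" for c :: real
      unfolding eq fact_Suc of_nat_mult of_nat_fact by (simp only: mult_ac)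
    finally have "((1/2) gchoose n) * fact n * ((1/2 - n) * c) = ((1/2) gchoose Suc n) * fact (Suc n) * c"
      for c :: real .
    moreover have "1/2 - real n - 1 = 1/2 - Suc n"
      by simp
    ultimately show ?thesis
      by (simp only:)
  qed
  finally show ?case .
qed (simp add: powr_half_sqrt)

text \<open>By Vandermonde's convolution the coefficients of the square are
  \<open>(1 choose n) * x powr (1 - n)\<close>, nonzero only for \<open>n \<le> 1\<close>. The right
  side is the Taylor series of the identity at \<open>x\<close>.\<close>

lemma taylor_fps_sqrt_power2:
  assumes "0 < x"
  shows "taylor_fps sqrt x ^ 2 = fps_const x + fps_X"
proof (rule fps_ext)
  fix n
  have "fps_nth (taylor_fps sqrt x ^ 2) n
      = (\<Sum>i\<le>n. x powr (1 - real n) * (((1/2) gchoose i) * ((1/2) gchoose (n - i))))"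
    unfolding power2_eq_square fps_mult_nth atLeast0AtMost
  proof (rule sum.cong)
    fix i assume "i \<in> {..n}"
    then have "x powr (1/2 - i) * x powr (1/2 - real (n - i)) = x powr (1 - real n)"
      by (simp flip: powr_add)
    then show "fps_nth (taylor_fps sqrt x) i * fps_nth (taylor_fps sqrt x) (n - i)
        = x powr (1 - real n) * (((1/2) gchoose i) * ((1/2) gchoose (n - i)))"
      using assms by (simp add: taylor_fps_def higher_deriv_sqrt mult_ac)
  qed simp
  also have "\<dots> = x powr (1 - real n) * (1 gchoose n)"
    using gbinomial_Vandermonde[of "1/2 :: real" "1/2" n]
    by (simp add: atLeast0AtMost flip: sum_distrib_left)
  also have "\<dots> = x powr (1 - real n) * (1 choose n)"
    using binomial_gbinomial[of 1 n, where 'a=real] by simp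
  also have "\<dots> = fps_nth (fps_const x + fps_X) n"
    using assms by (cases "n = 0"; cases "n = 1") (auto simp: fps_X_def binomial_eq_0)
  finally show "fps_nth (taylor_fps sqrt x ^ 2) n = fps_nth (fps_const x + fps_X) n" .
qed

section \<open>Even supernumbers\<close>

text \<open>By disjointness every pair in \<open>T \<times> U\<close> is an inversion for exactly
  one of the two orders of concatenation.\<close>

lemma gsign_swap:
  assumes "finite T" "finite U" "T \<inter> U = {}"
  shows "gsign T U * gsign U T = (-1) ^ (card T * card U)"
proof -
  let ?A = "{(i, j). i \<in> T \<and> j \<in> U \<and> j < i}" and ?B = "{(i, j). i \<in> U \<and> j \<in> T \<and> j < i}"
  have "T \<times> U = ?A \<union> prod.swap ` ?B"
    using assms(3) by (auto simp: image_iff)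
  moreover have "card (?A \<union> prod.swap ` ?B) = card ?A + card (prod.swap ` ?B)"
    using assms by (intro card_Un_disjoint) (auto intro: finite_inversions)
  moreover have "card (prod.swap ` ?B) = card ?B"
    by (rule card_image) (auto simp: inj_on_def)
  ultimately have "card T * card U = card ?A + card ?B"
    by (simp flip: card_cartesian_product)
  then show ?thesis
    by (simp add: gsign_def power_add)
qed

lemma gsign_commute:
  assumes "finite T" "finite U" "T \<inter> U = {}" "even (card T)"
  shows "gsign T U = gsign U T"
proof -
  have "gsign T U * gsign U T = 1"
    using gsign_swap[OF assms(1-3)] assms(4) by simp
  moreover have "gsign T U = 1 \<or> gsign T U = -1" "gsign U T = 1 \<or> gsign U T = -1"
    by (auto simp: gsign_def minus_one_power_iff)
  ultimately show ?thesis by auto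
qed

text \<open>Replacing each subset of \<open>S\<close> by its complement exchanges the factors, and
  the sorting sign does not change because the monomials of \<open>a\<close> have even length. Even
  elements are thus central.\<close>

lemma boson_commute:
  assumes "a \<in> bosons"
  shows "a * x = x * a"
proof (rule supernum_eqI)
  fix S
  show "coeff (a * x) S = coeff (x * a) S"
  proof (cases "finite S")
    case fin: True
    have "coeff (a * x) S = (\<Sum>T\<in>Pow S. gsign (S - T) T * coeff a (S - T) * coeff x T)"
      unfolding coeff_mult
      by (rule sum.reindex_bij_witness[of _ "\<lambda>T. S - T" "\<lambda>T. S - T"]) (auto simp: double_diff)
    also have "\<dots> = coeff (x * a) S"
      unfolding coeff_mult
    proof (intro sum.cong refl)
      fix T assume "T \<in> Pow S"
      then have "gsign (S - T) T = gsign T (S - T)" if "coeff a (S - T) \<noteq> 0"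
        using that fin assms by (intro gsign_commute) (auto simp: bosons_def intro: finite_subset)
      then show "gsign (S - T) T * coeff a (S - T) * coeff x T =
          gsign T (S - T) * coeff x T * coeff a (S - T)"
        by fastforce
    qed
    finally show ?thesis .
  qed (simp add: coeff_infinite)
qed

lemma boson_left_commute: "a \<in> bosons \<Longrightarrow> x * (a * y) = a * (x * y)"
  by (metis boson_commute mult.assoc)

text \<open>A conditional substitute for \<open>mult_ac\<close>. Both orientations appear because
  either of two swapped factors may be the even one.\<close>

lemmas boson_ac = mult.assoc boson_commute boson_commute[symmetric]
  boson_left_commute boson_left_commute[symmetric]

lemma boson_power2_mult: "a \<in> bosons \<Longrightarrow> (a * x)\<^sup>2 = a\<^sup>2 * x\<^sup>2"
  by (simp add: power2_eq_square boson_ac)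

lemma coeff_mult_nonzeroE:
  assumes "coeff (a * b) S \<noteq> 0"
  obtains T U where "coeff a T \<noteq> 0" "coeff b U \<noteq> 0" "card S = card T + card U"
proof -
  obtain T where "T \<in> Pow S" and ne: "gsign T (S - T) * coeff a T * coeff b (S - T) \<noteq> 0"
    using assms unfolding coeff_mult by (rule sum.not_neutral_contains_not_neutral)
  moreover have "finite S"
    using assms by (rule finite_of_coeff)
  ultimately have "card S = card T + card (S - T)"
    by (metis PowD card_Diff_subset card_mono finite_subset le_add_diff_inverse)
  with ne show ?thesis
    by (intro that[of T "S - T"]) auto
qed

section \<open>Parity and body under the algebra operations\<close>

lemma bosons_0 [simp, intro]: "0 \<in> bosons"
  and bosons_1 [simp, intro]: "1 \<in> bosons"
  and bosons_scaleR [simp, intro]: "a \<in> bosons \<Longrightarrow> r *\<^sub>R a \<in> bosons"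
  by (auto simp: bosons_def coeff_one split: if_splits)

lemma bosons_add [simp, intro]: "a \<in> bosons \<Longrightarrow> b \<in> bosons \<Longrightarrow> a + b \<in> bosons"
  and bosons_diff [simp, intro]: "a \<in> bosons \<Longrightarrow> b \<in> bosons \<Longrightarrow> a - b \<in> bosons"
  unfolding bosons_def by (auto, (metis add_0 diff_0_right)+)

lemma bosons_mult [simp, intro]: "a \<in> bosons \<Longrightarrow> b \<in> bosons \<Longrightarrow> a * b \<in> bosons"
  by (auto simp: bosons_def elim!: coeff_mult_nonzeroE)

lemma fermions_mult_fermions [simp, intro]: "a \<in> fermions \<Longrightarrow> b \<in> fermions \<Longrightarrow> a * b \<in> bosons"
  by (auto simp: bosons_def fermions_def elim!: coeff_mult_nonzeroE)

lemma fermions_0 [simp, intro]: "0 \<in> fermions"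
  by (simp add: fermions_def)

lemma bosons_of_real [simp, intro]: "of_real r \<in> bosons"
  by (simp add: of_real_def)

lemma bosons_power [simp, intro]: "a \<in> bosons \<Longrightarrow> a ^ n \<in> bosons"
  by (induction n) auto

lemma bosons_sum: "(\<And>i. i \<in> I \<Longrightarrow> f i \<in> bosons) \<Longrightarrow> sum f I \<in> bosons"
  by (induction I rule: infinite_finite_induct) auto

lemma bosons_soul [simp, intro]: "a \<in> bosons \<Longrightarrow> soul a \<in> bosons"
  by (simp add: soul_def)

lemma bosons_fps_eval: "a \<in> bosons \<Longrightarrow> fps_eval F a \<in> bosons"
  unfolding fps_eval_def by (intro bosons_sum) auto

lemma bosons_superext [simp, intro]: "a \<in> bosons \<Longrightarrow> superext f a \<in> bosons"
  unfolding superext_def by (intro bosons_sum) auto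

lemma body_0 [simp]: "body 0 = 0"
  and body_1 [simp]: "body 1 = 1"
  and body_add [simp]: "body (a + b) = body a + body b"
  and body_diff [simp]: "body (a - b) = body a - body b"
  and body_scaleR [simp]: "body (r *\<^sub>R a) = r * body a"
  and body_mult [simp]: "body (a * b) = body a * body b"
  by (simp_all add: body_def coeff_one coeff_mult)

lemma body_of_real [simp]: "body (of_real r) = r"
  by (simp add: of_real_def)

lemma body_power [simp]: "body (a ^ n) = body a ^ n"
  by (induction n) auto

lemma body_sum: "body (sum f I) = (\<Sum>i\<in>I. body (f i))"
  by (induction I rule: infinite_finite_induct) auto

lemma bosons_numeral [simp, intro]: "numeral n \<in> bosons"
  and body_numeral [simp]: "body (numeral n) = numeral n"
  using bosons_of_real[of "numeral n"] body_of_real[of "numeral n"] by simp_all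

lemma body_soul [simp]: "body (soul a) = 0"
  by (simp add: soul_def)

lemma body_fermion [simp]: "a \<in> fermions \<Longrightarrow> body a = 0"
  by (auto simp: fermions_def body_def)

lemma soul_nilpotentE:
  obtains N where "soul a ^ N = 0"
  using soul_nilpotent by blast

lemma of_real_body_plus_soul: "of_real (body a) + soul a = a"
  by (simp add: soul_def)

lemma body_fps_eval_soul: "body (fps_eval F (soul a)) = fps_nth F 0"
proof -
  obtain N where "soul a ^ N = 0" by (rule soul_nilpotentE)
  then have N: "soul a ^ Suc N = 0" by simp
  show ?thesis
    unfolding fps_eval_eq_sum[OF N]
    by (simp add: body_sum sum.lessThan_Suc_shift del: sum.lessThan_Suc)
qed

section \<open>Taylor extension\<close>

lemma superext_eq_fps_eval: "superext f a = fps_eval (taylor_fps f (body a)) (soul a)"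
  by (simp add: superext_def fps_eval_def taylor_fps_def)

lemma body_superext [simp]: "body (superext f a) = f (body a)"
  by (simp add: superext_eq_fps_eval body_fps_eval_soul taylor_fps_nth_0)

text \<open>Evaluation at the soul is a ring homomorphism, so it carries the identity of Taylor
  series over.\<close>

lemma superext_cosh_sinh: "superext cosh a ^ 2 - superext sinh a ^ 2 = 1"
proof -
  obtain N where N: "soul a ^ N = 0" by (rule soul_nilpotentE)
  show ?thesis
    using arg_cong[OF cosh_sinh_taylor_fps[of "body a"], of "\<lambda>F. fps_eval F (soul a)"]
      fps_eval_const[OF N, of 1]
    by (simp add: superext_eq_fps_eval fps_eval_diff[OF N] fps_eval_power[OF N])
qed

lemma superext_cos_sin: "superext cos a ^ 2 + superext sin a ^ 2 = 1"
proof -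
  obtain N where N: "soul a ^ N = 0" by (rule soul_nilpotentE)
  show ?thesis
    using arg_cong[OF cos_sin_taylor_fps[of "body a"], of "\<lambda>F. fps_eval F (soul a)"]
      fps_eval_const[OF N, of 1]
    by (simp add: superext_eq_fps_eval fps_eval_add[OF N] fps_eval_power[OF N])
qed

lemma superext_sqrt_power2:
  assumes "0 < body a"
  shows "superext sqrt a ^ 2 = a"
proof -
  obtain N where N: "soul a ^ N = 0" by (rule soul_nilpotentE)
  show ?thesis
    using arg_cong[OF taylor_fps_sqrt_power2[OF assms], of "\<lambda>F. fps_eval F (soul a)"]
    by (simp add: superext_eq_fps_eval fps_eval_add[OF N] fps_eval_power[OF N]
        fps_eval_const[OF N] fps_eval_X[OF N] of_real_body_plus_soul)
qed

section \<open>Inverses, square roots and preimages of even supernumbers\<close>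

lemma inverse_supernum_eqI:
  assumes "a * b = 1" "b * a = 1"
  shows "inverse a = (b :: supernum)"
proof -
  have "(THE b. a * b = 1 \<and> b * a = 1) = b"
    by (rule the_equality) (use assms in \<open>auto, metis mult.assoc mult_1 mult_1_right\<close>)
  with assms show ?thesis
    unfolding inverse_supernum_def by auto
qed

text \<open>The series \<open>fps_const (body a) + fps_X\<close> is invertible because the body is
  nonzero; its inverse, evaluated at the soul, inverts \<open>a\<close>.\<close>

lemma boson_inverse:
  assumes "a \<in> bosons" "body a \<noteq> 0"
  shows bosons_inverse: "inverse a \<in> bosons"
    and boson_right_inverse: "a * inverse a = 1"
    and body_inverse: "body (inverse a) = inverse (body a)"
proof -
  obtain N where N: "soul a ^ N = 0" by (rule soul_nilpotentE)
  let ?F = "fps_const (body a) + fps_X"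
  define b where "b = fps_eval (inverse ?F) (soul a)"
  have b: "b \<in> bosons"
    unfolding b_def using assms by (intro bosons_fps_eval) auto
  have "fps_eval (inverse ?F * ?F) (soul a) = b * a"
    by (simp add: fps_eval_mult[OF N] fps_eval_add[OF N] fps_eval_const[OF N] fps_eval_X[OF N]
        of_real_body_plus_soul b_def)
  moreover have "inverse ?F * ?F = fps_const 1"
    using assms(2) by (subst inverse_mult_eq_1) auto
  ultimately have ba: "b * a = 1"
    by (simp add: fps_eval_const[OF N] del: fps_const_1_eq_1)
  then have ab: "a * b = 1"
    using boson_commute[OF b, of a] by simp
  have inv: "inverse a = b"
    using ab ba by (rule inverse_supernum_eqI)
  show "inverse a \<in> bosons" "a * inverse a = 1"
    using b ab by (simp_all add: inv)
  then show "body (inverse a) = inverse (body a)"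
    by (metis body_1 body_mult inverse_unique)
qed

lemma boson_mult_left_cancel:
  assumes "a \<in> bosons" "body a \<noteq> 0" "a * x = a * y"
  shows "x = y"
  using assms boson_right_inverse[OF assms(1,2)] boson_commute[OF assms(1), of "inverse a"]
  by (metis mult.assoc mult_1)

text \<open>The factor \<open>a + b\<close> of \<open>a\<^sup>2 - b\<^sup>2\<close> has positive
  body and can be cancelled. This later fixes the signs of the sines.\<close>

lemma boson_power2_eq_imp_eq:
  assumes "a \<in> bosons" "b \<in> bosons" "0 < body a" "0 < body b" "a ^ 2 = b ^ 2"
  shows "a = b"
proof -
  have "(a + b) * a = (a + b) * b"
    using assms(5) boson_commute[OF assms(1), of b]
    by (simp add: power2_eq_square algebra_simps)
  then show ?thesis
    by (rule boson_mult_left_cancel[rotated 2]) (use assms in auto)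
qed

text \<open>Injectivity on \<open>I\<close> pins down the body of a preimage, and inverting the
  Taylor series of \<open>f\<close> at \<open>x0\<close> pins down its soul.\<close>

lemma superext_preimage_ex1:
  assumes P: "P \<in> bosons" and x0: "x0 \<in> I" "f x0 = body P" "deriv f x0 \<noteq> 0"
    and inj: "\<And>x. x \<in> I \<Longrightarrow> f x = body P \<Longrightarrow> x = x0"
  shows "\<exists>!d. d \<in> bosons \<and> body d \<in> I \<and> superext f d = P"
proof -
  obtain N where N: "soul P ^ N = 0" by (rule soul_nilpotentE)
  \<comment> \<open>Subtracting the value makes the constant term zero, as compositional inversion
    requires; the linear coefficient is \<open>deriv f x0\<close>.\<close>
  define G where "G = taylor_fps f x0 - fps_const (f x0)"
  have G: "fps_nth G 0 = 0" "fps_nth G 1 \<noteq> 0"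
    using x0(3) by (simp_all add: G_def taylor_fps_nth_0 taylor_fps_nth_1[unfolded One_nat_def])
  have evG: "fps_eval G m = fps_eval (taylor_fps f x0) m - of_real (body P)"
    if "m ^ M = 0" for m :: supernum and M
    by (simp add: G_def fps_eval_diff[OF that] fps_eval_const[OF that] x0)
  let ?n = "fps_eval (fps_inv G) (soul P)"
  note n = fps_eval_ex1_preimage(1,2)[OF N G]
  have body_n: "body ?n = 0"
    by (simp add: body_fps_eval_soul fps_inv_def)
  let ?d = "of_real x0 + ?n"
  have soul_d: "soul ?d = ?n"
    unfolding soul_def[of ?d] by (simp add: body_n)
  have "fps_eval (taylor_fps f x0) ?n = P"
    using evG[OF n(1)] n(2) of_real_body_plus_soul[of P] by (simp add: algebra_simps)
  then have "?d \<in> bosons \<and> body ?d \<in> I \<and> superext f ?d = P"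
    using P x0 by (simp add: superext_eq_fps_eval soul_d body_n bosons_fps_eval)
  moreover have "d = ?d" if d: "d \<in> bosons" "body d \<in> I" "superext f d = P" for d
  proof -
    obtain M where M: "soul d ^ M = 0" by (rule soul_nilpotentE)
    have "body d = x0"
      using inj d body_superext by metis
    moreover have "fps_eval G (soul d) = soul P"
      using evG[OF M] d(3) \<open>body d = x0\<close> by (simp add: superext_eq_fps_eval soul_def)
    then have "soul d = ?n"
      by (rule fps_eval_ex1_preimage(3)[OF N G M])
    ultimately show ?thesis
      using of_real_body_plus_soul[of d] by simp
  qed
  ultimately show ?thesis by blast
qed

lemma superext_cosh_preimage_ex1:
  assumes "P \<in> bosons" "1 < body P"
  shows "\<exists>!d. d \<in> bosons \<and> 0 < body d \<and> superext cosh d = P"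
proof -
  have "\<exists>!d. d \<in> bosons \<and> body d \<in> {0<..} \<and> superext cosh d = P"
  proof (rule superext_preimage_ex1[of _ "arcosh (body P)"])
    show "x = arcosh (body P)" if "x \<in> {0<..}" "cosh x = body P" for x
      using that arcosh_cosh_real[of x] by auto
  qed (use assms in \<open>auto simp: deriv_cosh\<close>)
  then show ?thesis by simp
qed

lemma superext_cos_preimage_ex1:
  assumes "P \<in> bosons" "-1 < body P" "body P < 1"
  shows "\<exists>!d. d \<in> bosons \<and> 0 < body d \<and> body d < pi \<and> superext cos d = P"
proof -
  have *: "0 < arccos (body P)" "arccos (body P) < pi"
    using assms arccos_lt_bounded by auto
  have "\<exists>!d. d \<in> bosons \<and> body d \<in> {0<..<pi} \<and> superext cos d = P"
  proof (rule superext_preimage_ex1[of _ "arccos (body P)"])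
    show "x = arccos (body P)" if "x \<in> {0<..<pi}" "cos x = body P" for x
      using that arccos_cos[of x] by auto
    show "deriv cos (arccos (body P)) \<noteq> 0"
      using sin_gt_zero[OF *] by (simp add: deriv_cos)
  qed (use assms * in auto)
  then show ?thesis by (simp add: conj_assoc)
qed

section \<open>The classical hyperboloid\<close>

text \<open>The pairing at the level of bodies, where the odd coordinates vanish and are dropped: a
  form of signature (1, 2).\<close>

definition mink :: "real \<times> real \<times> real \<Rightarrow> real \<times> real \<times> real \<Rightarrow> real" where
  "mink u v = (fst u * fst (snd v) + fst v * fst (snd u)) / 2 - snd (snd u) * snd (snd v)"

definition hyperboloid :: "(real \<times> real \<times> real) set" where
  "hyperboloid = {u. mink u u = 1 \<and> 0 < fst u + fst (snd u)}"

definition mink_geodesic :: "real \<times> real \<times> real \<Rightarrow> real \<times> real \<times> real \<Rightarrow> (real \<times> real \<times> real) set" where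
  "mink_geodesic u v = range (\<lambda>s. cosh s *\<^sub>R u + sinh s *\<^sub>R v)"

definition mink_collinear :: "(real \<times> real \<times> real) set \<Rightarrow> bool" where
  "mink_collinear S \<longleftrightarrow>
    (\<exists>u v. u \<in> hyperboloid \<and> mink v v = -1 \<and> mink u v = 0 \<and> S \<subseteq> mink_geodesic u v)"

lemma mink_commute: "mink u v = mink v u"
  and mink_add_left: "mink (u + w) v = mink u v + mink w v"
  and mink_diff_left: "mink (u - w) v = mink u v - mink w v"
  and mink_scaleR_left: "mink (r *\<^sub>R u) v = r * mink u v"
  by (simp_all add: mink_def algebra_simps add_divide_distrib diff_divide_distrib)

lemma mink_add_right: "mink v (u + w) = mink v u + mink v w"
  and mink_diff_right: "mink v (u - w) = mink v u - mink v w"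
  and mink_scaleR_right: "mink v (r *\<^sub>R u) = r * mink v u"
  by (simp_all only: mink_commute[of v] mink_add_left mink_diff_left mink_scaleR_left)

lemmas mink_linear = mink_add_left mink_diff_left mink_scaleR_left
  mink_add_right mink_diff_right mink_scaleR_right

text \<open>A reverse Cauchy-Schwarz inequality: the form is negative definite on the orthogonal
  complement of a vector of norm 1.\<close>

lemma mink_orthogonal_timelike:
  assumes "mink u u = 1" "mink u w = 0"
  shows "mink w w \<le> 0" "mink w w = 0 \<Longrightarrow> w = 0"
proof -
  obtain a b y where u: "u = (a, b, y)" by (metis prod_cases3)
  obtain c d z where w: "w = (c, d, z)" by (metis prod_cases3)
  have ab: "a * b = 1 + y\<^sup>2" and orth: "a * d + c * b = 2 * (y * z)"
    using assms by (simp_all add: u w mink_def power2_eq_square field_simps)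
  have "4 * (a * b) * (c * d) \<le> (a * d + c * b)\<^sup>2"
    using zero_le_power2[of "a * d - c * b"] by (simp add: power2_eq_square algebra_simps)
  then have key: "(1 + y\<^sup>2) * (c * d - z\<^sup>2) \<le> - z\<^sup>2"
    unfolding ab orth by (simp add: power2_eq_square algebra_simps)
  have pos: "0 < 1 + y\<^sup>2"
    by (simp add: add_pos_nonneg)
  have ww: "mink w w = c * d - z\<^sup>2"
    by (simp add: w mink_def power2_eq_square mult.commute)
  show "mink w w \<le> 0"
    using order_trans[OF key, of 0] pos by (simp add: ww mult_le_0_iff)
  show "w = 0" if "mink w w = 0"
  proof -
    have z: "z = 0" and "c * d = 0"
      using key that by (auto simp: ww)
    \<comment> \<open>\<open>a\<close> and \<open>b\<close> are nonzero, so once one of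
      \<open>c\<close>, \<open>d\<close> vanishes, \<open>orth\<close> makes the other vanish
      too.\<close>
    with orth ab pos show ?thesis
      by (auto simp: w zero_prod_def)
  qed
qed

text \<open>All of \<open>a\<close>, \<open>b\<close>, \<open>c\<close>, \<open>d\<close> are
  positive, and the inequality of arithmetic and geometric means for \<open>a * d\<close> and
  \<open>c * b\<close> bounds \<open>y * z\<close>.\<close>

lemma mink_hyperboloid_pos:
  assumes "u \<in> hyperboloid" "v \<in> hyperboloid"
  shows "0 < mink u v"
proof -
  obtain a b y where u: "u = (a, b, y)" by (metis prod_cases3)
  obtain c d z where v: "v = (c, d, z)" by (metis prod_cases3)
  have ab: "a * b = 1 + y\<^sup>2" "0 < a + b" and cd: "c * d = 1 + z\<^sup>2" "0 < c + d"
    using assms by (simp_all add: u v hyperboloid_def mink_def power2_eq_square field_simps)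
  have "0 < a * b" "0 < c * d"
    by (simp_all add: ab cd add_pos_nonneg)
  with ab cd have pos: "0 < a" "0 < b" "0 < c" "0 < d"
    by (smt (verit) mult_nonneg_nonpos mult_nonneg_nonpos2 zero_less_mult_iff)+
  have "(y * z)\<^sup>2 < (1 + y\<^sup>2) * (1 + z\<^sup>2)"
    by (simp add: algebra_simps power_mult_distrib add_pos_nonneg)
  also have "\<dots> = (a * d) * (c * b)"
    by (simp add: ab(1)[symmetric] cd(1)[symmetric] mult_ac)
  also have "\<dots> \<le> ((a * d + c * b) / 2)\<^sup>2"
    using zero_le_power2[of "a * d - c * b"] by (simp add: power2_eq_square field_simps)
  finally have "y * z < (a * d + c * b) / 2"
    using pos by (intro power_less_imp_less_base[of "y * z" 2]) auto
  then show ?thesis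
    by (simp add: u v mink_def)
qed

text \<open>The part \<open>?w\<close> of \<open>v\<close> orthogonal to \<open>u\<close> has norm
  \<open>1 - ?p\<^sup>2\<close>, which is negative unless \<open>?w = 0\<close>, that is, unless
  \<open>v = u\<close>.\<close>

lemma mink_hyperboloid_gt_1:
  assumes u: "u \<in> hyperboloid" and v: "v \<in> hyperboloid" and "u \<noteq> v"
  shows "1 < mink u v"
proof -
  let ?p = "mink u v" and ?w = "v - mink u v *\<^sub>R u"
  have uu: "mink u u = 1" and vv: "mink v v = 1"
    using u v by (auto simp: hyperboloid_def)
  have orth: "mink u ?w = 0" and ww: "mink ?w ?w = 1 - ?p\<^sup>2"
    by (simp_all add: mink_linear uu vv mink_commute[of v u] power2_eq_square)
  have pos: "0 < ?p"
    using u v by (rule mink_hyperboloid_pos)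
  have "1 \<le> ?p\<^sup>2"
    using mink_orthogonal_timelike(1)[OF uu orth] ww by simp
  moreover have "?p\<^sup>2 \<noteq> 1"
  proof
    assume *: "?p\<^sup>2 = 1"
    then have "?p = 1"
      using pos by (simp add: power2_eq_1_iff)
    with mink_orthogonal_timelike(2)[OF uu orth] ww \<open>u \<noteq> v\<close> show False
      by simp
  qed
  ultimately have "1\<^sup>2 < ?p\<^sup>2" by simp
  then show ?thesis
    using pos by (intro power_less_imp_less_base[of 1 2]) auto
qed

lemma mink_geodesic_memI:
  assumes "\<beta>\<^sup>2 = q\<^sup>2 - 1" "0 < q" "c = q *\<^sub>R u + \<beta> *\<^sub>R v"
  shows "c \<in> mink_geodesic u v"
proof -
  have "cosh (arsinh \<beta>) = q"
    using assms by (simp add: cosh_arsinh_real)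
  then show ?thesis
    unfolding mink_geodesic_def using assms(3) by (intro image_eqI[of _ _ "arsinh \<beta>"]) auto
qed

text \<open>For distinct points \<open>v\<close> is the unit tangent, and its formula is exported
  for the computation of the Gram determinant. Coincident points are covered so that triples with a
  repeated point count as collinear.\<close>

lemma mink_geodesic_through:
  assumes u: "u \<in> hyperboloid" and w: "w \<in> hyperboloid"
  obtains v where "mink v v = -1" "mink u v = 0" "u \<in> mink_geodesic u v" "w \<in> mink_geodesic u v"
    "u \<noteq> w \<Longrightarrow> v = (1 / sqrt ((mink u w)\<^sup>2 - 1)) *\<^sub>R (w - mink u w *\<^sub>R u)"
proof -
  have uu: "mink u u = 1" and ww: "mink w w = 1"
    using u w by (auto simp: hyperboloid_def)
  have base: "u \<in> mink_geodesic u v" for v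
    by (rule mink_geodesic_memI[of 0 1]) auto
  show ?thesis
  proof (cases "u = w")
    case True
    obtain a b y where ab: "u = (a, b, y)" by (metis prod_cases3)
    \<comment> \<open>The vector \<open>(a, - b, 0)\<close> is orthogonal to \<open>u\<close> and
      has norm \<open>- (a * b)\<close>; \<open>t\<close> normalizes it.\<close>
    define t where "t = 1 / sqrt (a * b)"
    have "a * b = 1 + y\<^sup>2"
      using uu by (simp add: ab mink_def power2_eq_square field_simps)
    then have "0 < a * b"
      by (simp add: add_pos_nonneg)
    then have "t * t * (a * b) = 1"
      by (auto simp: t_def)
    then have "mink (t * a, - (t * b), 0) (t * a, - (t * b), 0) = -1"
      by (simp add: mink_def algebra_simps)
    moreover have "mink u (t * a, - (t * b), 0) = 0"
      by (simp add: mink_def ab)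
    ultimately show ?thesis
      using True base by (intro that[of "(t * a, - (t * b), 0)"]) auto
  next
    case False
    define p where "p = mink u w"
    define s where "s = sqrt (p\<^sup>2 - 1)"
    have p: "1 < p"
      unfolding p_def using u w False by (rule mink_hyperboloid_gt_1)
    then have "1 < p\<^sup>2"
      by (simp add: one_less_power)
    then have s: "0 < s" "s\<^sup>2 = p\<^sup>2 - 1"
      by (auto simp: s_def)
    define v where "v = (1 / s) *\<^sub>R (w - p *\<^sub>R u)"
    have "mink v v = (1 - p\<^sup>2) / s\<^sup>2"
      by (simp add: v_def mink_linear uu ww mink_commute[of w u] p_def[symmetric] power2_eq_square)
    also have "\<dots> = -1"
      using s \<open>1 < p\<^sup>2\<close> by (simp add: divide_eq_eq)
    finally have "mink v v = -1" .
    moreover have "mink u v = 0"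
      by (simp add: v_def mink_linear uu p_def[symmetric])
    moreover have "w \<in> mink_geodesic u v"
      using s p by (intro mink_geodesic_memI[of s p]) (auto simp: v_def)
    ultimately show ?thesis
      using base by (intro that[of v]) (auto simp: v_def s_def p_def)
  qed
qed

text \<open>The Gram determinant equals
  \<open>(p\<^sup>2 - 1) * (q\<^sup>2 - 1) - (r - p * q)\<^sup>2\<close>. It is positive because
  \<open>w\<close> has a nonzero component orthogonal to the plane of the geodesic through
  \<open>u\<close> and \<open>v\<close>.\<close>

lemma mink_not_collinear:
  assumes u: "u \<in> hyperboloid" and v: "v \<in> hyperboloid" and w: "w \<in> hyperboloid"
    and nc: "\<not> mink_collinear {u, v, w}"
  shows "u \<noteq> v"
    and "0 < 1 + 2 * mink u v * mink u w * mink v w - (mink u v)\<^sup>2 - (mink u w)\<^sup>2 - (mink v w)\<^sup>2"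
proof -
  show "u \<noteq> v"
    using mink_geodesic_through[OF u w] nc u unfolding mink_collinear_def
    by (metis empty_subsetI insert_subset)
  define p q r where "p = mink u v" and "q = mink u w" and "r = mink v w"
  obtain t where t: "mink t t = -1" "mink u t = 0" "u \<in> mink_geodesic u t" "v \<in> mink_geodesic u t"
    and t_eq: "t = (1 / sqrt (p\<^sup>2 - 1)) *\<^sub>R (v - p *\<^sub>R u)"
    using mink_geodesic_through[OF u v] \<open>u \<noteq> v\<close> unfolding p_def by metis
  have uu: "mink u u = 1" and ww: "mink w w = 1"
    using u w by (auto simp: hyperboloid_def)
  \<comment> \<open>The coordinate of \<open>w\<close> along \<open>t\<close>; the sign comes from
    \<open>mink t t = -1\<close>.\<close>
  define \<beta> where "\<beta> = - mink w t"
  let ?n = "w - q *\<^sub>R u - \<beta> *\<^sub>R t"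
  have n: "mink u ?n = 0" "mink ?n ?n = 1 - q\<^sup>2 + \<beta>\<^sup>2"
    by (simp_all add: mink_linear uu ww t mink_commute[of t u] mink_commute[of w u]
        mink_commute[of t w] q_def \<beta>_def power2_eq_square)
  \<comment> \<open>Norm zero would make \<open>?n\<close> vanish and put \<open>w\<close> on the
    geodesic through \<open>u\<close> and \<open>v\<close>.\<close>
  have "1 - q\<^sup>2 + \<beta>\<^sup>2 \<noteq> 0"
  proof
    assume *: "1 - q\<^sup>2 + \<beta>\<^sup>2 = 0"
    then have "w = q *\<^sub>R u + \<beta> *\<^sub>R t"
      using mink_orthogonal_timelike(2)[OF uu n(1)] n(2) by (simp add: algebra_simps)
    then have "w \<in> mink_geodesic u t"
      using * mink_hyperboloid_pos[OF u w] by (intro mink_geodesic_memI[of \<beta> q]) (auto simp: q_def)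
    with t u nc show False
      unfolding mink_collinear_def by blast
  qed
  then have "\<beta>\<^sup>2 < q\<^sup>2 - 1"
    using mink_orthogonal_timelike(1)[OF uu n(1)] n(2) by simp
  moreover have "1 < p\<^sup>2"
    unfolding p_def using mink_hyperboloid_gt_1[OF u v \<open>u \<noteq> v\<close>] by (simp add: one_less_power)
  moreover from this have "\<beta>\<^sup>2 = (r - p * q)\<^sup>2 / (p\<^sup>2 - 1)"
    by (simp add: \<beta>_def t_eq mink_linear mink_commute[of w] p_def[symmetric] q_def[symmetric]
        r_def[symmetric] power_divide)
  ultimately have "(r - p * q)\<^sup>2 < (q\<^sup>2 - 1) * (p\<^sup>2 - 1)"
    by (simp add: divide_less_eq)
  then have "0 < 1 + 2 * p * q * r - p\<^sup>2 - q\<^sup>2 - r\<^sup>2"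
    by (simp add: power2_eq_square algebra_simps)
  then show "0 < 1 + 2 * mink u v * mink u w * mink v w - (mink u v)\<^sup>2 - (mink u w)\<^sup>2 - (mink v w)\<^sup>2"
    by (simp only: p_def q_def r_def)
qed

section \<open>Supertriangles\<close>

definition body_vec :: "svec \<Rightarrow> real \<times> real \<times> real" where
  "body_vec X = (body (fst X), body (fst (snd X)), body (fst (snd (snd X))))"

definition of_real_vec :: "real \<times> real \<times> real \<Rightarrow> svec" where
  "of_real_vec u = (of_real (fst u), of_real (fst (snd u)), of_real (snd (snd u)), 0, 0)"

lemma body_point_eq: "X \<in> super_minkowski \<Longrightarrow> body_point X = of_real_vec (body_vec X)"
  by (auto simp: super_minkowski_def body_point_def of_real_vec_def body_vec_def)

lemma body_pairing:
  "X \<in> super_minkowski \<Longrightarrow> Y \<in> super_minkowski \<Longrightarrow>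
    body (pairing X Y) = mink (body_vec X) (body_vec Y)"
  by (auto simp: super_minkowski_def body_vec_def mink_def)

lemma body_vec_hyperboloid: "X \<in> super_hyperbolic_plane \<Longrightarrow> body_vec X \<in> hyperboloid"
  using body_pairing[of X X]
  by (auto simp: super_hyperbolic_plane_def hyperboloid_def body_vec_def)

lemma pairing_of_real_vec: "pairing (of_real_vec u) (of_real_vec v) = of_real (mink u v)"
  by (simp add: of_real_vec_def mink_def of_real_def scaleR_add_right scaleR_add_left
      scaleR_diff_left add_divide_distrib mult.commute)

lemma of_real_vec_super_minkowski: "of_real_vec u \<in> super_minkowski"
  by (simp add: of_real_vec_def super_minkowski_def)

lemma of_real_vec_mink_geodesic:
  "of_real_vec ` mink_geodesic u v = supergeodesic (of_real_vec u) (of_real_vec v)"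
  unfolding mink_geodesic_def supergeodesic_def image_image
  by (simp add: of_real_vec_def)

text \<open>A real geodesic becomes a supergeodesic with zero odd coordinates. Contraposed, this
  turns the condition on bodies in \<open>supertriangle\<close> into classical
  non-collinearity.\<close>

lemma mink_collinear_imp_supergeodesic:
  assumes "mink_collinear S"
  shows "\<exists>L\<in>supergeodesics. of_real_vec ` S \<subseteq> L"
proof -
  obtain u v where uv: "u \<in> hyperboloid" "mink v v = -1" "mink u v = 0"
    and S: "S \<subseteq> mink_geodesic u v"
    using assms unfolding mink_collinear_def by blast
  have "of_real_vec u \<in> super_hyperbolic_plane"
    using uv(1) of_real_vec_super_minkowski[of u]
    by (simp add: super_hyperbolic_plane_def hyperboloid_def pairing_of_real_vec)
      (simp add: of_real_vec_def)
  moreover have "of_real_vec v \<in> super_hyperboloid"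
    using uv of_real_vec_super_minkowski[of v]
    by (simp add: super_hyperboloid_def pairing_of_real_vec)
  moreover have "pairing (of_real_vec u) (of_real_vec v) = 0"
    by (simp add: pairing_of_real_vec uv)
  ultimately have "supergeodesic (of_real_vec u) (of_real_vec v) \<in> supergeodesics"
    unfolding supergeodesics_def by blast
  with S show ?thesis
    unfolding of_real_vec_mink_geodesic[symmetric] by blast
qed

text \<open>Exchanging the arguments swaps the two summands of the odd part, with no sign from
  anticommutation; \<open>y * y'\<close> commutes because of an even factor.\<close>

lemma pairing_commute: "X \<in> super_minkowski \<Longrightarrow> pairing X Y = pairing Y X"
  by (cases X; cases Y) (auto simp: super_minkowski_def boson_ac algebra_simps)

lemma pairing_boson: "X \<in> super_minkowski \<Longrightarrow> Y \<in> super_minkowski \<Longrightarrow> pairing X Y \<in> bosons"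
  by (cases X; cases Y) (auto simp: super_minkowski_def)

lemma pairing_diff_left: "pairing (X - Y) Z = pairing X Z - pairing Y Z"
  by (cases X; cases Y; cases Z) (simp add: algebra_simps scaleR_diff_right)

lemma pairing_diff_right: "pairing Z (X - Y) = pairing Z X - pairing Z Y"
  by (cases X; cases Y; cases Z) (simp add: algebra_simps scaleR_diff_right)

lemma pairing_smult_left: "c \<in> bosons \<Longrightarrow> pairing (smult c X) Y = c * pairing X Y"
  by (cases X; cases Y) (simp add: boson_ac algebra_simps)

lemma pairing_smult_right: "c \<in> bosons \<Longrightarrow> pairing X (smult c Y) = c * pairing X Y"
  by (cases X; cases Y) (simp add: boson_ac algebra_simps)

section \<open>Gram determinant, sides and angles of a supertriangle\<close>

lemma supertriangle_permute:
  assumes "supertriangle X Y Z"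
  shows "supertriangle X Z Y" "supertriangle Y X Z"
  using assms unfolding supertriangle_def by (simp_all add: insert_commute)

text \<open>The determinant of the matrix of pairings, whose diagonal entries are 1 on
  \<open>super_hyperbolic_plane\<close>.\<close>

definition gram_det :: "svec \<Rightarrow> svec \<Rightarrow> svec \<Rightarrow> supernum" where
  "gram_det X Y Z = 1 + 2 * pairing X Y * pairing X Z * pairing Y Z
    - (pairing X Y)\<^sup>2 - (pairing X Z)\<^sup>2 - (pairing Y Z)\<^sup>2"

lemma supertriangle_bodies:
  assumes "supertriangle X Y Z"
  shows "1 < body (pairing X Y)" "0 < body (gram_det X Y Z)"
proof -
  have XYZ: "X \<in> super_hyperbolic_plane" "Y \<in> super_hyperbolic_plane" "Z \<in> super_hyperbolic_plane"
    using assms by (auto simp: supertriangle_def)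
  then have M: "X \<in> super_minkowski" "Y \<in> super_minkowski" "Z \<in> super_minkowski"
    by (auto simp: super_hyperbolic_plane_def)
  note H = XYZ[THEN body_vec_hyperboloid]
  have nc: "\<not> mink_collinear {body_vec X, body_vec Y, body_vec Z}"
    using assms M mink_collinear_imp_supergeodesic[of "{body_vec X, body_vec Y, body_vec Z}"]
    by (auto simp: supertriangle_def body_point_eq)
  show "1 < body (pairing X Y)"
    using mink_hyperboloid_gt_1[OF H(1,2) mink_not_collinear(1)[OF H nc]] by (simp add: body_pairing M)
  show "0 < body (gram_det X Y Z)"
    using mink_not_collinear(2)[OF H nc] by (simp add: gram_det_def body_pairing M)
qed

text \<open>Lets one square root serve for the sines at all three vertices.\<close>

lemma gram_det_permute:
  assumes "X \<in> super_minkowski" "Y \<in> super_minkowski" "Z \<in> super_minkowski"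
  shows "gram_det X Z Y = gram_det X Y Z" "gram_det Y X Z = gram_det X Y Z"
proof -
  note P = pairing_boson[OF assms(1,2)] pairing_boson[OF assms(1,3)] pairing_boson[OF assms(2,3)]
  show "gram_det X Z Y = gram_det X Y Z" "gram_det Y X Z = gram_det X Y Z"
    using P assms
    by (simp_all add: gram_det_def pairing_commute[of Z] pairing_commute[of Y X] boson_ac algebra_simps)
qed

text \<open>\<open>superext_cosh_preimage_ex1\<close> makes \<open>sdist\<close> well defined. The
  hyperbolic sine then has the same square as \<open>s\<close>, and both have positive body.\<close>

lemma supertriangle_sides:
  assumes "supertriangle X Y Z"
  defines "s \<equiv> superext sqrt ((pairing X Y)\<^sup>2 - 1)"
  shows "s \<in> bosons" "0 < body s" "s\<^sup>2 = (pairing X Y)\<^sup>2 - 1"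
    and "superext cosh (sdist X Y) = pairing X Y" "superext sinh (sdist X Y) = s"
proof -
  let ?p = "pairing X Y"
  have "X \<in> super_minkowski" "Y \<in> super_minkowski"
    using assms(1) by (auto simp: supertriangle_def super_hyperbolic_plane_def)
  then have p: "?p \<in> bosons"
    by (rule pairing_boson)
  have body_p: "1 < body ?p"
    using assms(1) by (rule supertriangle_bodies)
  then have pos: "0 < body (?p\<^sup>2 - 1)"
    by (simp add: one_less_power)
  show s: "s \<in> bosons" "0 < body s" "s\<^sup>2 = ?p\<^sup>2 - 1"
    using p pos by (simp_all add: s_def superext_sqrt_power2 del: body_diff body_power)
  have d: "sdist X Y \<in> bosons \<and> 0 < body (sdist X Y) \<and> superext cosh (sdist X Y) = ?p"
    unfolding sdist_def by (rule theI') (rule superext_cosh_preimage_ex1[OF p body_p])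
  then show "superext cosh (sdist X Y) = ?p" by simp
  have "(superext sinh (sdist X Y))\<^sup>2 = s\<^sup>2"
    using superext_cosh_sinh[of "sdist X Y"] d s(3) by (simp add: algebra_simps)
  then show "superext sinh (sdist X Y) = s"
    by (rule boson_power2_eq_imp_eq[rotated 4]) (use d s in simp_all)
qed

text \<open>The Gram identity makes the squares of the two right sides add up to 1. As the second
  has positive body, the body of the first lies strictly between -1 and 1, so the angle exists, and
  the sign of its sine is determined.\<close>

lemma supertriangle_angle:
  assumes "supertriangle X Y Z"
  defines "i \<equiv> inverse (superext sqrt ((pairing X Y)\<^sup>2 - 1))"
    and "j \<equiv> inverse (superext sqrt ((pairing X Z)\<^sup>2 - 1))"
  shows "superext cos (sangle X Y Z) = i * j * (pairing X Y * pairing X Z - pairing Y Z)"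
    and "superext sin (sangle X Y Z) = i * j * superext sqrt (gram_det X Y Z)"
proof -
  let ?p = "pairing X Y" and ?q = "pairing X Z" and ?r = "pairing Y Z"
  let ?s = "superext sqrt (?p\<^sup>2 - 1)" and ?t = "superext sqrt (?q\<^sup>2 - 1)"
  let ?w = "superext sqrt (gram_det X Y Z)"
  let ?P = "i * j * (?p * ?q - ?r)"
  have M: "X \<in> super_minkowski" "Y \<in> super_minkowski" "Z \<in> super_minkowski"
    and XX: "pairing X X = 1"
    using assms(1) by (auto simp: supertriangle_def super_hyperbolic_plane_def)
  note p = pairing_boson[OF M(1,2)] and q = pairing_boson[OF M(1,3)] and r = pairing_boson[OF M(2,3)]
  note s = supertriangle_sides(1-3)[OF assms(1)]
  note t = supertriangle_sides(1-3)[OF supertriangle_permute(1)[OF assms(1)]]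
  have i: "i \<in> bosons" "?s * i = 1" "0 < body i"
    using s boson_inverse[of ?s] by (simp_all add: i_def)
  have j: "j \<in> bosons" "?t * j = 1" "0 < body j"
    using t boson_inverse[of ?t] by (simp_all add: j_def)
  have D: "gram_det X Y Z \<in> bosons"
    using p q r by (simp add: gram_det_def)
  have body_D: "0 < body (gram_det X Y Z)"
    using assms(1) by (rule supertriangle_bodies)
  have w: "?w \<in> bosons" "0 < body ?w" "?w\<^sup>2 = gram_det X Y Z"
    using D body_D by (simp_all add: superext_sqrt_power2)
  have P: "?P \<in> bosons"
    using i j p q r by simp
  have "(?s * ?t)\<^sup>2 - (?p * ?q - ?r)\<^sup>2 = gram_det X Y Z"
  proof -
    have "(?s * ?t)\<^sup>2 = ?s\<^sup>2 * ?t\<^sup>2"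
      using s(1) by (rule boson_power2_mult)
    also have "\<dots> - (?p * ?q - ?r)\<^sup>2 = gram_det X Y Z"
      unfolding s(3) t(3) gram_det_def mult_2 using p q r
      by (simp add: power2_eq_square boson_ac algebra_simps)
    finally show ?thesis .
  qed
  moreover have "(i * j * ?w)\<^sup>2 = (i * j)\<^sup>2 * gram_det X Y Z"
    using boson_power2_mult[of "i * j" ?w] i(1) j(1) by (simp only: w(3) bosons_mult)
  moreover have "?P\<^sup>2 = (i * j)\<^sup>2 * (?p * ?q - ?r)\<^sup>2"
    using i(1) j(1) by (intro boson_power2_mult) auto
  moreover have "(i * j)\<^sup>2 * (?s * ?t)\<^sup>2 = 1"
  proof -
    have "(i * j)\<^sup>2 * (?s * ?t)\<^sup>2 = (?s * i)\<^sup>2 * (?t * j)\<^sup>2"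
      using i(1) j(1) s(1) t(1) by (simp only: power2_eq_square boson_ac)
    then show ?thesis
      by (simp add: i j)
  qed
  ultimately have sum: "?P\<^sup>2 + (i * j * ?w)\<^sup>2 = 1"
    by (metis add_diff_cancel_left' add_diff_eq diff_add_cancel distrib_left)
  have "0 < body (i * j * ?w)"
    using i j w by simp
  then have "0 < (body (i * j * ?w))\<^sup>2"
    by (rule zero_less_power)
  then have "(body ?P)\<^sup>2 < 1"
    using arg_cong[OF sum, of body] by (simp only: body_add body_power body_1)
  then have "-1 < body ?P" "body ?P < 1"
    unfolding abs_square_less_1 by linarith+
  note ex1 = superext_cos_preimage_ex1[OF P this]
  have "- pairing (unit_tangent X Y) (unit_tangent X Z) = ?P"
  proof -
    \<comment> \<open>Bilinearity leaves a \<open>pairing Y X\<close>; symmetry is applied only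
      afterwards, and the terms beyond \<open>?r - ?p * ?q\<close> then cancel.\<close>
    have "- pairing (unit_tangent X Y) (unit_tangent X Z) =
        - (i * (j * (?r - ?q * pairing Y X - (?p * ?q - ?q * (?p * 1)))))"
      unfolding unit_tangent_def divide_supernum_def mult_1 i_def[symmetric] j_def[symmetric]
      using i j p q r
      by (simp add: pairing_smult_left pairing_smult_right pairing_diff_left pairing_diff_right XX
          boson_ac algebra_simps)
    also have "\<dots> = ?P"
      unfolding pairing_commute[OF M(2), of X] using i j p q r by (simp add: boson_ac algebra_simps)
    finally show ?thesis .
  qed
  then have a: "sangle X Y Z \<in> bosons \<and> 0 < body (sangle X Y Z) \<and> body (sangle X Y Z) < pi \<and>
      superext cos (sangle X Y Z) = ?P"
    unfolding sangle_def by (simp only:) (rule theI'[OF ex1])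
  then show cos: "superext cos (sangle X Y Z) = ?P"
    by simp
  have "(superext sin (sangle X Y Z))\<^sup>2 = (i * j * ?w)\<^sup>2"
    using superext_cos_sin[of "sangle X Y Z"] sum unfolding cos by (metis add_left_cancel)
  then show "superext sin (sangle X Y Z) = i * j * ?w"
    by (rule boson_power2_eq_imp_eq[rotated 4]) (use a i j w sin_gt_zero in simp_all)
qed

theorem corollary5p1:
  fixes A B C :: svec and lA lB lC a b c :: supernum
  assumes "supertriangle A B C"
    and "lA = sdist B C" "lB = sdist A C" "lC = sdist A B"
    and "a = sangle A B C" "b = sangle B A C" "c = sangle C A B"
  shows "superext cosh lA =
      superext cosh lB * superext cosh lC - superext sinh lB * superext sinh lC * superext cos a \<and>
    superext cos a =
      - (superext cos b * superext cos c) + superext sin b * superext sin c * superext cosh lA \<and>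
    superext sin a / superext sinh lA = superext sin b / superext sinh lB \<and>
    superext sin b / superext sinh lB = superext sin c / superext sinh lC"
proof -
  \<comment> \<open>The first, second and fourth orders yield the three sides; the first, third and
    fifth yield the angles at \<open>A\<close>, \<open>B\<close> and \<open>C\<close>.\<close>
  have ABC: "supertriangle A B C" "supertriangle A C B" "supertriangle B A C"
    "supertriangle B C A" "supertriangle C A B"
    using assms(1) supertriangle_permute by blast+
  have M: "A \<in> super_minkowski" "B \<in> super_minkowski" "C \<in> super_minkowski"
    using assms(1) by (auto simp: supertriangle_def super_hyperbolic_plane_def)
  define p q r where "p = pairing A B" and "q = pairing A C" and "r = pairing B C"
  have pqr: "p \<in> bosons" "q \<in> bosons" "r \<in> bosons"
    using M by (simp_all add: p_def q_def r_def pairing_boson)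
  have sym: "pairing B A = p" "pairing C A = q" "pairing C B = r"
    using M by (simp_all add: p_def q_def r_def pairing_commute)
  define D w where "D = gram_det A B C" and "w = superext sqrt D"
  have gram: "gram_det A B C = D" "gram_det B A C = D" "gram_det C A B = D"
    using gram_det_permute M by (simp_all add: D_def)
  define x y z where "x = superext sqrt (p\<^sup>2 - 1)" and "y = superext sqrt (q\<^sup>2 - 1)"
    and "z = superext sqrt (r\<^sup>2 - 1)"
  define i j k where "i = inverse x" and "j = inverse y" and "k = inverse z"
  note defs = p_def[symmetric] q_def[symmetric] r_def[symmetric] sym gram w_def[symmetric]
    x_def[symmetric] y_def[symmetric] z_def[symmetric] i_def[symmetric] j_def[symmetric] k_def[symmetric]
  note xs = supertriangle_sides[OF ABC(1), unfolded defs]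
    and ys = supertriangle_sides[OF ABC(2), unfolded defs]
    and zs = supertriangle_sides[OF ABC(4), unfolded defs]
  note as = supertriangle_angle[OF ABC(1), unfolded defs]
    and bs = supertriangle_angle[OF ABC(3), unfolded defs]
    and cs = supertriangle_angle[OF ABC(5), unfolded defs]
  have ijk: "i \<in> bosons" "j \<in> bosons" "k \<in> bosons" "x * i = 1" "y * j = 1" "z * k = 1"
    using boson_inverse[of x] boson_inverse[of y] boson_inverse[of z] xs ys zs
    by (simp_all add: i_def j_def k_def)
  have D: "D = 1 + 2 * p * q * r - p\<^sup>2 - q\<^sup>2 - r\<^sup>2"
    by (simp add: D_def gram_det_def p_def q_def r_def)
  then have "D \<in> bosons"
    using pqr by simp
  moreover have "0 < body D"
    using supertriangle_bodies(2)[OF assms(1)] by (simp add: D_def)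
  ultimately have w: "w \<in> bosons" "w\<^sup>2 = D"
    by (simp_all add: w_def superext_sqrt_power2)

  \<comment> \<open>The roots \<open>x\<close>, \<open>y\<close> from the hyperbolic sines cancel
    their inverses in the cosine of the angle.\<close>
  have cosine1: "r = q * p - y * x * (i * j * (p * q - r))"
  proof -
    have "y * x * (i * j * (p * q - r)) = (x * i) * (y * j) * (p * q - r)"
      using xs(1) ys(1) ijk(1-3) by (simp only: boson_ac)
    then show ?thesis
      using pqr by (simp add: ijk boson_ac algebra_simps)
  qed

  \<comment> \<open>A polynomial identity in \<open>p\<close>, \<open>q\<close>, \<open>r\<close>.
    Multiplied by \<open>i * j * k\<^sup>2\<close> it becomes the second law, as
    \<open>z * k = 1\<close> absorbs \<open>z\<^sup>2\<close>.\<close>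
  have "(p * q - r) * z\<^sup>2 + (p * r - q) * (q * r - p) = r * D"
    unfolding zs(3) D mult_2 using pqr by (simp add: power2_eq_square boson_ac algebra_simps)
  then have "i * j * k\<^sup>2 * ((p * q - r) * z\<^sup>2 + (p * r - q) * (q * r - p)) = i * j * k\<^sup>2 * (r * w\<^sup>2)"
    by (simp add: w)
  moreover have "i * j * k\<^sup>2 * ((p * q - r) * z\<^sup>2 + (p * r - q) * (q * r - p)) =
      i * j * (p * q - r) * (z * k)\<^sup>2 + i * k * (p * r - q) * (j * k * (q * r - p))"
    using pqr ijk(1-3) zs(1) by (simp add: power2_eq_square boson_ac algebra_simps)
  moreover have "i * j * k\<^sup>2 * (r * w\<^sup>2) = i * k * w * (j * k * w) * r"
    using pqr ijk(1-3) w(1) by (simp add: power2_eq_square boson_ac)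
  ultimately have cosine2: "i * j * (p * q - r) =
      - (i * k * (p * r - q) * (j * k * (q * r - p))) + i * k * w * (j * k * w) * r"
    by (simp add: ijk algebra_simps)

  \<comment> \<open>Each quotient in the law of sines is the product of \<open>i\<close>,
    \<open>j\<close>, \<open>k\<close> and \<open>w\<close> in some order.\<close>
  have sine: "i * j * w * k = i * k * w * j" "i * k * w * j = j * k * w * i"
    using ijk(1-3) w(1) by (simp_all only: boson_ac)
  show ?thesis
    unfolding assms(2-7) as bs cs xs(4,5) ys(4,5) zs(4,5) divide_supernum_def defs
    using cosine1 cosine2 sine by blast
qed

end
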